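(* If $\dim M=8$, then, writing $\bar A_a=2\cosh(\tfrac a2c)\frac{1}{\cosh^2(\frac12\bar c)}\widehat A(TM,\nabla^{TM})$ and $\bar A_b=2\cosh(\tfrac b2c)\cosh(\tfrac12\bar c)\widehat A(TM,\nabla^{TM})$, $$\{\bar A_a\}^{(8)}-\{\bar A_b\}^{(8)}-\tfrac{1}{16}\{\bar A_b\,\mathrm{ch}(\bar W)\}^{(8)}=-\tfrac1{24}\{P'\bar A_a\}^{(8)}+\tfrac1{24}\{P'\bar A_b\}^{(8)}+\tfrac1{384}\{P'\bar A_b\,\mathrm{ch}(\bar W)\}^{(8)}+\tfrac1{18432}\{P'^2\cdot2\,\mathrm{ch}(\bar W)\}^{(8)}.$$
   Context: $M$ is a Riemannian manifold with Levi-Civita connection $\nabla^{TM}$ and curvature $R^{TM}$; characteristic forms are Chern–Weil forms of the given connections; $\omega^{(i)}$ is the degree-$i$ component. $\mathrm{ch}(E)=\mathrm{tr}\exp(\frac{\sqrt{-1}}{2\pi}R^E)$, extended additively to formal differences; $\widetilde E=E-\dim E\cdot\mathbb{C}$. $\widehat A(TM,\nabla^{TM})=\det^{1/2}\Big(\frac{\frac{\sqrt{-1}}{4\pi}R^{TM}}{\sinh(\frac{\sqrt{-1}}{4\pi}R^{TM})}\Big)$; $p_1$ is the first Pontryagin form. $\xi$ is a complex line bundle with Hermitian connection; $(\xi^{\otimes m})_{\mathbb{R}}$ is the underlying real oriented rank-two bundle of $\xi^{\otimes m}$, $\xi_{\mathbb{R}}=(\xi^{\otimes1})_{\mathbb{R}}$,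 and the formal Chern roots of $\xi_{\mathbb{R}}\otimes\mathbb{C}$ are $\pm c$. $\eta$ is a rank-two real oriented Euclidean bundle with Euclidean connection, $\eta_{\mathbb{C}}=\eta\otimes\mathbb{C}$ with formal Chern roots $\pm\bar c$. $a,b\in\mathbb{Z}$; $P'=p_1(TM)-(a^2+2b^2)p_1(\xi_{\mathbb{R}})$; $\bar W=\widetilde{(\xi^{\otimes b})_{\mathbb{R}}\otimes\mathbb{C}}-\widetilde{(\xi^{\otimes a})_{\mathbb{R}}\otimes\mathbb{C}}+3\widetilde{\eta_{\mathbb{C}}}$. *)

theory Defs
  imports "HOL-Analysis.Analysis"
begin

text \<open>A characteristic form is represented as a (real-analytic) function of the
  formal Chern roots: x 0, ..., x 3 (the roots of TM tensor C are +-x j, j<4,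
  since dim M = 8), c (roots +-c of xi_R tensor C) and cb (roots +-cb of eta_C).
  Each root has form degree 2, so the degree-2k component of a form is the
  k-th Taylor coefficient in t after scaling all roots by t.\<close>

type_synonym charform = "(nat \<Rightarrow> real) \<Rightarrow> real \<Rightarrow> real \<Rightarrow> real"

definition deg_comp :: "nat \<Rightarrow> charform \<Rightarrow> charform" where
  "deg_comp d F = (\<lambda>x c cb. if even d then
      (deriv ^^ (d div 2)) (\<lambda>t. F (\<lambda>j. t * x j) (t * c) (t * cb)) 0 / fact (d div 2)
    else 0)"

definition ahat_fun :: "real \<Rightarrow> real" where
  "ahat_fun y = (if y = 0 then 1 else (y / 2) / sinh (y / 2))"

definition Ahat_TM :: charform where
  "Ahat_TM = (\<lambda>x c cb. \<Prod>j<4. ahat_fun (x j))"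

definition p1_TM :: charform where
  "p1_TM = (\<lambda>x c cb. \<Sum>j<4. (x j)\<^sup>2)"

definition p1_xiR :: charform where
  "p1_xiR = (\<lambda>x c cb. c\<^sup>2)"

text \<open>ch((xi^m)_R tensor C) = e^{mc} + e^{-mc}; ch(eta_C) = e^{cb} + e^{-cb}.\<close>
definition ch_xiR_pow :: "int \<Rightarrow> charform" where
  "ch_xiR_pow m = (\<lambda>x c cb. exp (of_int m * c) + exp (- (of_int m * c)))"

definition ch_etaC :: charform where
  "ch_etaC = (\<lambda>x c cb. exp cb + exp (- cb))"

text \<open>ch of E tilde = ch E - dim E; all bundles here have complex rank 2.\<close>
definition ch_Wbar :: "int \<Rightarrow> int \<Rightarrow> charform" where
  "ch_Wbar a b = (\<lambda>x c cb. (ch_xiR_pow b x c cb - 2) - (ch_xiR_pow a x c cb - 2)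
                          + 3 * (ch_etaC x c cb - 2))"

definition P' :: "int \<Rightarrow> int \<Rightarrow> charform" where
  "P' a b = (\<lambda>x c cb. p1_TM x c cb - of_int (a\<^sup>2 + 2 * b\<^sup>2) * p1_xiR x c cb)"

definition Abar_a :: "int \<Rightarrow> charform" where
  "Abar_a a = (\<lambda>x c cb. 2 * cosh (of_int a / 2 * c) * (1 / (cosh (cb / 2))\<^sup>2) * Ahat_TM x c cb)"

definition Abar_b :: "int \<Rightarrow> charform" where
  "Abar_b b = (\<lambda>x c cb. 2 * cosh (of_int b / 2 * c) * cosh (cb / 2) * Ahat_TM x c cb)"

end

theory Submission
  imports Defs
begin

text \<open>All forms here are even in \<open>t\<close>, so their components of degree 0, 4 and 8
  multiply like power series in \<open>t\<^sup>2\<close> truncated after the quadratic term; for \<open>Abar_a\<close>, \<open>Abar_b\<close>,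
  \<open>ch Wbar\<close> and \<open>P'\<close> they follow from the Taylor series of \<open>cosh\<close> and of \<open>(y/2) / sinh (y/2)\<close>.
  The degree-8 component of \<open>Ahat(TM)\<close> enters both sides with the same coefficient and cancels,
  leaving a polynomial identity in the remaining root data.\<close>

lemma fps_nth_conv_deriv_field:
  fixes f :: "'a :: {banach, real_normed_field} fps"
  assumes "fps_conv_radius f > 0"
  shows   "fps_nth f n = (deriv ^^ n) (eval_fps f) 0 / fact n"
  using assms
proof (induction n arbitrary: f)
  case 0
  thus ?case by (simp add: eval_fps_def)
next
  case (Suc n f)
  have "(deriv ^^ Suc n) (eval_fps f) 0 = (deriv ^^ n) (deriv (eval_fps f)) 0"
    unfolding funpow_Suc_right o_def ..
  also have "eventually (\<lambda>z::'a. z \<in> eball 0 (fps_conv_radius f)) (nhds 0)"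
    using Suc.prems by (intro eventually_nhds_in_open) (auto simp: zero_ereal_def)
  hence "eventually (\<lambda>z. deriv (eval_fps f) z = eval_fps (fps_deriv f) z) (nhds 0)"
    by eventually_elim (simp add: eval_fps_deriv)
  hence "(deriv ^^ n) (deriv (eval_fps f)) 0 = (deriv ^^ n) (eval_fps (fps_deriv f)) 0"
    by (intro higher_deriv_cong_ev refl)
  also have "\<dots> / fact n = fps_nth (fps_deriv f) n"
    using Suc.prems fps_conv_radius_deriv[of f]
    by (intro Suc.IH [symmetric]) auto
  also have "\<dots> / of_nat (Suc n) = fps_nth f (Suc n)"
    by (simp add: fps_deriv_def del: of_nat_Suc)
  finally show ?case by (simp add: field_split_simps)
qed

lemma fps_nth_fps_expansion_field:
  fixes f :: "'a :: {banach, real_normed_field} \<Rightarrow> 'a"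
  assumes "f has_fps_expansion F"
  shows   "fps_nth F n = (deriv ^^ n) f 0 / fact n"
proof -
  have "fps_nth F n = (deriv ^^ n) (eval_fps F) 0 / fact n"
    using assms by (intro fps_nth_conv_deriv_field) (auto simp: has_fps_expansion_def)
  also have "(deriv ^^ n) (eval_fps F) 0 = (deriv ^^ n) f 0"
    using assms by (intro higher_deriv_cong_ev) (auto simp: has_fps_expansion_def)
  finally show ?thesis .
qed

definition even_jet :: "'a :: zero fps \<Rightarrow> 'a \<Rightarrow> 'a \<Rightarrow> 'a \<Rightarrow> bool" where
  "even_jet F f0 f2 f4 \<longleftrightarrow>
     fps_nth F 0 = f0 \<and> fps_nth F 1 = 0 \<and> fps_nth F 2 = f2 \<and> fps_nth F 3 = 0 \<and> fps_nth F 4 = f4"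

lemma even_jet_cong:
  "even_jet F f0 f2 f4 \<Longrightarrow> f0 = g0 \<Longrightarrow> f2 = g2 \<Longrightarrow> f4 = g4 \<Longrightarrow> even_jet F g0 g2 g4"
  by simp

lemma even_jet_const: "even_jet (fps_const k) k 0 0"
  by (simp add: even_jet_def)

lemma even_jet_fps_const_X_power2: "even_jet (fps_const k * fps_X ^ 2) 0 k 0"
  by (simp add: even_jet_def fps_X_power_iff)

lemma even_jet_add:
  fixes F G :: "'a :: monoid_add fps"
  shows "even_jet F f0 f2 f4 \<Longrightarrow> even_jet G g0 g2 g4 \<Longrightarrow>
           even_jet (F + G) (f0 + g0) (f2 + g2) (f4 + g4)"
  by (simp add: even_jet_def)

lemma even_jet_diff:
  fixes F G :: "'a :: ab_group_add fps"
  shows "even_jet F f0 f2 f4 \<Longrightarrow> even_jet G g0 g2 g4 \<Longrightarrow>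
           even_jet (F - G) (f0 - g0) (f2 - g2) (f4 - g4)"
  by (simp add: even_jet_def)

lemma even_jet_mult:
  fixes F G :: "'a :: comm_semiring_1 fps"
  assumes "even_jet F f0 f2 f4" "even_jet G g0 g2 g4"
  shows "even_jet (F * G) (f0 * g0) (f0 * g2 + f2 * g0) (f0 * g4 + f2 * g2 + f4 * g0)"
  using assms
  by (simp add: even_jet_def fps_mult_nth atLeast0AtMost numeral_eq_Suc lessThan_Suc_atMost)

lemma even_jet_inverse:
  fixes F :: "'a :: field fps"
  assumes F: "even_jet F f0 f2 f4" and "f0 \<noteq> 0"
  shows "even_jet (inverse F) (1 / f0) (- f2 / f0 ^ 2) (f2 ^ 2 / f0 ^ 3 - f4 / f0 ^ 2)"
proof -
  let ?g = "fps_nth (inverse F)"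
  have "inverse F * F = 1"
    using F \<open>f0 \<noteq> 0\<close> by (simp add: even_jet_def inverse_mult_eq_1)
  hence coeff: "fps_nth (inverse F * F) n = (if n = 0 then 1 else 0)" for n
    by simp
  note F_coeffs = F[unfolded even_jet_def]
  note convolution = fps_mult_nth atLeast0AtMost numeral_eq_Suc lessThan_Suc_atMost
  have g0: "?g 0 = 1 / f0"
    using coeff[of 0] F_coeffs \<open>f0 \<noteq> 0\<close> by (simp add: convolution field_simps)
  have g1: "?g 1 = 0"
    using coeff[of 1] F_coeffs \<open>f0 \<noteq> 0\<close> by (simp add: convolution)
  have g2: "?g 2 = - f2 / f0 ^ 2"
  proof -
    have "?g 0 * f2 + ?g 2 * f0 = 0"
      using coeff[of 2] F_coeffs g1 by (simp add: convolution)
    then show ?thesis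
      unfolding g0 using \<open>f0 \<noteq> 0\<close> by (simp add: field_simps power2_eq_square add_eq_0_iff)
  qed
  have g3: "?g 3 = 0"
    using coeff[of 3] F_coeffs g1 \<open>f0 \<noteq> 0\<close> by (simp add: convolution)
  have g4: "?g 4 = f2 ^ 2 / f0 ^ 3 - f4 / f0 ^ 2"
  proof -
    have "?g 0 * f4 + ?g 2 * f2 + ?g 4 * f0 = 0"
      using coeff[of 4] F_coeffs g1 g3 by (simp add: convolution)
    then show ?thesis
      unfolding g0 g2 using \<open>f0 \<noteq> 0\<close>
      by (simp add: field_simps power2_eq_square power3_eq_cube add_eq_0_iff)
  qed
  show ?thesis
    using g0 g1 g2 g3 g4 by (simp add: even_jet_def)
qed

definition fps_cosh :: "'a :: field_char_0 \<Rightarrow> 'a fps" where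
  "fps_cosh k = fps_const (1 / 2) * (fps_exp k + fps_exp (- k))"

definition fps_sinh :: "'a :: field_char_0 \<Rightarrow> 'a fps" where
  "fps_sinh k = fps_const (1 / 2) * (fps_exp k - fps_exp (- k))"

lemma has_fps_expansion_cosh:
  fixes k :: "'a :: {banach, real_normed_field}"
  shows "(\<lambda>t. cosh (k * t)) has_fps_expansion fps_cosh k"
proof -
  have "(\<lambda>t. 1 / 2 * (exp (k * t) + exp (- k * t))) has_fps_expansion fps_cosh k"
    unfolding fps_cosh_def by (intro fps_expansion_intros)
  thus ?thesis
    by (simp add: cosh_def scaleR_conv_of_real)
qed

lemma has_fps_expansion_sinh:
  fixes k :: "'a :: {banach, real_normed_field}"
  shows "(\<lambda>t. sinh (k * t)) has_fps_expansion fps_sinh k"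
proof -
  have "(\<lambda>t. 1 / 2 * (exp (k * t) - exp (- k * t))) has_fps_expansion fps_sinh k"
    unfolding fps_sinh_def by (intro fps_expansion_intros)
  thus ?thesis
    by (simp add: sinh_def scaleR_conv_of_real)
qed

lemma even_jet_fps_cosh: "even_jet (fps_cosh k) 1 (k ^ 2 / 2) (k ^ 4 / 24)"
  by (simp add: even_jet_def fps_cosh_def fact_numeral)

lemma even_jet_fps_shift_sinh: "even_jet (fps_shift 1 (fps_sinh k)) k (k ^ 3 / 6) (k ^ 5 / 120)"
  by (simp add: even_jet_def fps_sinh_def fact_numeral)

text \<open>\<open>f0\<close>, \<open>f2\<close>, \<open>f4\<close> are the components of degree 0, 4 and 8; those of degree 2 and 6 vanish.\<close>

definition form_jet :: "charform \<Rightarrow> (nat \<Rightarrow> real) \<Rightarrow> real \<Rightarrow> real \<Rightarrow> real \<Rightarrow> real \<Rightarrow> real \<Rightarrow> bool" where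
  "form_jet F x c cb f0 f2 f4 \<longleftrightarrow>
     (\<exists>S. (\<lambda>t. F (\<lambda>j. t * x j) (t * c) (t * cb)) has_fps_expansion S \<and> even_jet S f0 f2 f4)"

lemma form_jetI:
  "(\<lambda>t. F (\<lambda>j. t * x j) (t * c) (t * cb)) has_fps_expansion S \<Longrightarrow> even_jet S f0 f2 f4 \<Longrightarrow>
     form_jet F x c cb f0 f2 f4"
  unfolding form_jet_def by blast

lemma form_jet_cong:
  "form_jet F x c cb f0 f2 f4 \<Longrightarrow> f0 = g0 \<Longrightarrow> f2 = g2 \<Longrightarrow> f4 = g4 \<Longrightarrow> form_jet F x c cb g0 g2 g4"
  by simp

lemma deg_comp_8_eq:
  assumes "form_jet F x c cb f0 f2 f4"
  shows "deg_comp 8 F x c cb = f4"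
proof -
  obtain S where S: "(\<lambda>t. F (\<lambda>j. t * x j) (t * c) (t * cb)) has_fps_expansion S" "even_jet S f0 f2 f4"
    using assms unfolding form_jet_def by blast
  have "deg_comp 8 F x c cb = (deriv ^^ 4) (\<lambda>t. F (\<lambda>j. t * x j) (t * c) (t * cb)) 0 / fact 4"
    by (simp add: deg_comp_def)
  also have "\<dots> = fps_nth S 4"
    by (rule fps_nth_fps_expansion_field [OF S(1), symmetric])
  also have "\<dots> = f4"
    using S(2) by (simp add: even_jet_def)
  finally show ?thesis .
qed

lemma form_jet_const: "form_jet (\<lambda>x c cb. k) x c cb k 0 0"
  by (rule form_jetI [OF has_fps_expansion_const even_jet_const])

lemma form_jet_add:
  assumes "form_jet F x c cb f0 f2 f4" "form_jet G x c cb g0 g2 g4"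
  shows "form_jet (\<lambda>x c cb. F x c cb + G x c cb) x c cb (f0 + g0) (f2 + g2) (f4 + g4)"
proof -
  obtain S T where S: "(\<lambda>t. F (\<lambda>j. t * x j) (t * c) (t * cb)) has_fps_expansion S" "even_jet S f0 f2 f4"
    and T: "(\<lambda>t. G (\<lambda>j. t * x j) (t * c) (t * cb)) has_fps_expansion T" "even_jet T g0 g2 g4"
    using assms unfolding form_jet_def by blast
  show ?thesis
    using has_fps_expansion_add [OF S(1) T(1)] even_jet_add [OF S(2) T(2)] by (rule form_jetI)
qed

lemma form_jet_diff:
  assumes "form_jet F x c cb f0 f2 f4" "form_jet G x c cb g0 g2 g4"
  shows "form_jet (\<lambda>x c cb. F x c cb - G x c cb) x c cb (f0 - g0) (f2 - g2) (f4 - g4)"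
proof -
  obtain S T where S: "(\<lambda>t. F (\<lambda>j. t * x j) (t * c) (t * cb)) has_fps_expansion S" "even_jet S f0 f2 f4"
    and T: "(\<lambda>t. G (\<lambda>j. t * x j) (t * c) (t * cb)) has_fps_expansion T" "even_jet T g0 g2 g4"
    using assms unfolding form_jet_def by blast
  show ?thesis
    using has_fps_expansion_diff [OF S(1) T(1)] even_jet_diff [OF S(2) T(2)] by (rule form_jetI)
qed

lemma form_jet_mult:
  assumes "form_jet F x c cb f0 f2 f4" "form_jet G x c cb g0 g2 g4"
  shows "form_jet (\<lambda>x c cb. F x c cb * G x c cb) x c cb
           (f0 * g0) (f0 * g2 + f2 * g0) (f0 * g4 + f2 * g2 + f4 * g0)"
proof -
  obtain S T where S: "(\<lambda>t. F (\<lambda>j. t * x j) (t * c) (t * cb)) has_fps_expansion S" "even_jet S f0 f2 f4"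
    and T: "(\<lambda>t. G (\<lambda>j. t * x j) (t * c) (t * cb)) has_fps_expansion T" "even_jet T g0 g2 g4"
    using assms unfolding form_jet_def by blast
  show ?thesis
    using has_fps_expansion_mult [OF S(1) T(1)] even_jet_mult [OF S(2) T(2)] by (rule form_jetI)
qed

lemma form_jet_power2:
  assumes "form_jet F x c cb f0 f2 f4"
  shows "form_jet (\<lambda>x c cb. (F x c cb)\<^sup>2) x c cb (f0 ^ 2) (2 * f0 * f2) (2 * f0 * f4 + f2 ^ 2)"
  using form_jet_mult [OF assms assms] by (simp add: power2_eq_square algebra_simps)

lemma form_jet_inverse:
  assumes "form_jet F x c cb f0 f2 f4" "f0 \<noteq> 0"
  shows "form_jet (\<lambda>x c cb. inverse (F x c cb)) x c cb
           (1 / f0) (- f2 / f0 ^ 2) (f2 ^ 2 / f0 ^ 3 - f4 / f0 ^ 2)"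
proof -
  obtain S where S: "(\<lambda>t. F (\<lambda>j. t * x j) (t * c) (t * cb)) has_fps_expansion S" "even_jet S f0 f2 f4"
    using assms(1) unfolding form_jet_def by blast
  have "fps_nth S 0 \<noteq> 0"
    using S(2) assms(2) by (simp add: even_jet_def)
  with S show ?thesis
    by (intro form_jetI [OF has_fps_expansion_inverse even_jet_inverse]) (use assms(2) in auto)
qed

lemma form_jet_cosh:
  assumes linear: "\<And>t. L (\<lambda>j. t * x j) (t * c) (t * cb) = t * L x c cb"
  shows "form_jet (\<lambda>x c cb. cosh (L x c cb)) x c cb 1 ((L x c cb)\<^sup>2 / 2) ((L x c cb) ^ 4 / 24)"
proof (rule form_jetI [OF _ even_jet_fps_cosh])
  show "(\<lambda>t. cosh (L (\<lambda>j. t * x j) (t * c) (t * cb))) has_fps_expansion fps_cosh (L x c cb)"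
    unfolding linear by (subst mult.commute) (rule has_fps_expansion_cosh)
qed

lemma form_jet_ahat_fun:
  assumes linear: "\<And>t. L (\<lambda>j. t * x j) (t * c) (t * cb) = t * L x c cb"
  shows "form_jet (\<lambda>x c cb. ahat_fun (L x c cb)) x c cb
           1 (- (L x c cb)\<^sup>2 / 24) (7 * (L x c cb) ^ 4 / 5760)"
proof (cases "L x c cb = 0")
  case True
  have "form_jet (\<lambda>x c cb. ahat_fun (L x c cb)) x c cb 1 0 0"
    by (rule form_jetI [OF _ even_jet_const]) (simp add: linear True ahat_fun_def)
  with True show ?thesis
    by simp
next
  case False
  define y where "y = L x c cb"
  have "y \<noteq> 0"
    using False by (simp add: y_def)
  let ?Sinh = "fps_sinh (y / 2)"
  have Sinh_1: "fps_nth ?Sinh 1 = y / 2"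
    by (simp add: fps_sinh_def)
  hence "?Sinh \<noteq> 0"
    using \<open>y \<noteq> 0\<close> by auto
  hence "1 \<le> subdegree ?Sinh"
    by (rule subdegree_geI) (simp add: fps_sinh_def)
  from has_fps_expansion_shift [OF has_fps_expansion_sinh this Sinh_1 [symmetric]]
  have "(\<lambda>t. 2 / y * (if t = 0 then y / 2 else sinh (y / 2 * t) / t ^ 1))
          has_fps_expansion fps_const (2 / y) * fps_shift 1 ?Sinh"
    by (rule has_fps_expansion_cmult_left)
  hence "(\<lambda>t. inverse (2 / y * (if t = 0 then y / 2 else sinh (y / 2 * t) / t ^ 1)))
          has_fps_expansion inverse (fps_const (2 / y) * fps_shift 1 ?Sinh)"
    by (rule has_fps_expansion_inverse) (use \<open>y \<noteq> 0\<close> in \<open>simp add: fps_sinh_def\<close>)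
  moreover have "(\<lambda>t. inverse (2 / y * (if t = 0 then y / 2 else sinh (y / 2 * t) / t ^ 1)))
      = (\<lambda>t. ahat_fun (L (\<lambda>j. t * x j) (t * c) (t * cb)))"
    using False by (auto simp: linear y_def ahat_fun_def field_simps)
  moreover have "even_jet (inverse (fps_const (2 / y) * fps_shift 1 ?Sinh))
                   1 (- y\<^sup>2 / 24) (7 * y ^ 4 / 5760)"
    by (rule even_jet_cong [OF even_jet_inverse [OF even_jet_mult [OF even_jet_const
          even_jet_fps_shift_sinh]]])
       (use \<open>y \<noteq> 0\<close> in \<open>simp_all add: field_simps eval_nat_numeral\<close>)
  ultimately show ?thesis
    unfolding y_def by (auto intro: form_jetI)
qed

text \<open>The degree-8 component of \<open>Ahat(TM)\<close> is left symbolic: it cancels in the theorem.\<close>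

lemma form_jet_Ahat_TM:
  "form_jet Ahat_TM x c cb 1 (- p1_TM x c cb / 24) (deg_comp 8 Ahat_TM x c cb)"
proof -
  have Ahat_TM_expand:
    "Ahat_TM = (\<lambda>x c cb. ahat_fun (x 0) * ahat_fun (x 1) * ahat_fun (x 2) * ahat_fun (x 3))"
    by (simp add: Ahat_TM_def lessThan_nat_numeral mult_ac)
  have ahat: "form_jet (\<lambda>x c cb. ahat_fun (x j)) x c cb
                1 (- (x j)\<^sup>2 / 24) (7 * (x j) ^ 4 / 5760)" for j
    by (rule form_jet_ahat_fun) simp
  note J = form_jet_mult [OF form_jet_mult [OF form_jet_mult [OF ahat [of 0] ahat [of 1]] ahat [of 2]]
      ahat [of 3], folded Ahat_TM_expand]
  show ?thesis
    by (rule form_jet_cong [OF J])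
       (simp_all add: deg_comp_8_eq [OF J] p1_TM_def lessThan_nat_numeral field_simps)
qed

lemma form_jet_sech2_half:
  "form_jet (\<lambda>x c cb. 1 / (cosh (cb / 2))\<^sup>2) x c cb 1 (- cb\<^sup>2 / 4) (cb ^ 4 / 24)"
proof -
  have "form_jet (\<lambda>x c cb. cosh (cb / 2)) x c cb 1 ((cb / 2)\<^sup>2 / 2) ((cb / 2) ^ 4 / 24)"
    by (rule form_jet_cosh) simp
  then have "form_jet (\<lambda>x c cb. inverse ((cosh (cb / 2))\<^sup>2)) x c cb 1 (- cb\<^sup>2 / 4) (cb ^ 4 / 24)"
    by (rule form_jet_cong [OF form_jet_inverse [OF form_jet_power2]]) (simp_all add: field_simps)
  then show ?thesis
    by (simp add: inverse_eq_divide)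
qed

lemma form_jet_Abar_a:
  "form_jet (Abar_a a) x c cb 2
     ((of_int a * c)\<^sup>2 / 4 - cb\<^sup>2 / 2 - p1_TM x c cb / 12)
     (2 * deg_comp 8 Ahat_TM x c cb + cb\<^sup>2 * p1_TM x c cb / 48 + cb ^ 4 / 12
      - (of_int a * c)\<^sup>2 * p1_TM x c cb / 96 - (of_int a * c)\<^sup>2 * cb\<^sup>2 / 16 + (of_int a * c) ^ 4 / 192)"
proof -
  have "form_jet (\<lambda>x c cb. cosh (of_int a / 2 * c)) x c cb
          1 ((of_int a / 2 * c)\<^sup>2 / 2) ((of_int a / 2 * c) ^ 4 / 24)"
    by (rule form_jet_cosh) simp
  note J = form_jet_mult [OF form_jet_mult [OF form_jet_mult [OF form_jet_const [of 2] this]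
      form_jet_sech2_half] form_jet_Ahat_TM]
  show ?thesis
    unfolding Abar_a_def by (rule form_jet_cong [OF J]) (simp_all add: field_simps)
qed

lemma form_jet_Abar_b:
  "form_jet (Abar_b b) x c cb 2
     ((of_int b * c)\<^sup>2 / 4 + cb\<^sup>2 / 4 - p1_TM x c cb / 12)
     (2 * deg_comp 8 Ahat_TM x c cb - cb\<^sup>2 * p1_TM x c cb / 96 + cb ^ 4 / 192
      - (of_int b * c)\<^sup>2 * p1_TM x c cb / 96 + (of_int b * c)\<^sup>2 * cb\<^sup>2 / 32 + (of_int b * c) ^ 4 / 192)"
proof -
  have "form_jet (\<lambda>x c cb. cosh (of_int b / 2 * c)) x c cb
          1 ((of_int b / 2 * c)\<^sup>2 / 2) ((of_int b / 2 * c) ^ 4 / 24)"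
    by (rule form_jet_cosh) simp
  moreover have "form_jet (\<lambda>x c cb. cosh (cb / 2)) x c cb 1 ((cb / 2)\<^sup>2 / 2) ((cb / 2) ^ 4 / 24)"
    by (rule form_jet_cosh) simp
  ultimately show ?thesis
    unfolding Abar_b_def
    by (rule form_jet_cong [OF form_jet_mult [OF form_jet_mult [OF form_jet_mult [OF form_jet_const [of 2]]]
          form_jet_Ahat_TM]])
       (simp_all add: field_simps)
qed

lemma form_jet_ch_xiR_pow:
  "form_jet (ch_xiR_pow m) x c cb 2 ((of_int m * c)\<^sup>2) ((of_int m * c) ^ 4 / 12)"
proof -
  have "form_jet (\<lambda>x c cb. cosh (of_int m * c)) x c cb
          1 ((of_int m * c)\<^sup>2 / 2) ((of_int m * c) ^ 4 / 24)"
    by (rule form_jet_cosh) simp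
  from form_jet_mult [OF form_jet_const [of 2] this]
  have "form_jet (\<lambda>x c cb. 2 * cosh (of_int m * c)) x c cb
          2 ((of_int m * c)\<^sup>2) ((of_int m * c) ^ 4 / 12)"
    by (rule form_jet_cong) simp_all
  moreover have "ch_xiR_pow m = (\<lambda>x c cb. 2 * cosh (of_int m * c))"
    by (simp add: ch_xiR_pow_def cosh_def fun_eq_iff)
  ultimately show ?thesis
    by simp
qed

lemma form_jet_ch_etaC: "form_jet ch_etaC x c cb 2 (cb\<^sup>2) (cb ^ 4 / 12)"
proof -
  have "form_jet (\<lambda>x c cb. cosh cb) x c cb 1 (cb\<^sup>2 / 2) (cb ^ 4 / 24)"
    by (rule form_jet_cosh) simp
  from form_jet_mult [OF form_jet_const [of 2] this]
  have "form_jet (\<lambda>x c cb. 2 * cosh cb) x c cb 2 (cb\<^sup>2) (cb ^ 4 / 12)"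
    by (rule form_jet_cong) simp_all
  moreover have "ch_etaC = (\<lambda>x c cb. 2 * cosh cb)"
    by (simp add: ch_etaC_def cosh_def fun_eq_iff)
  ultimately show ?thesis
    by simp
qed

lemma form_jet_ch_Wbar:
  "form_jet (ch_Wbar a b) x c cb 0
     ((of_int b * c)\<^sup>2 - (of_int a * c)\<^sup>2 + 3 * cb\<^sup>2)
     (((of_int b * c) ^ 4 - (of_int a * c) ^ 4 + 3 * cb ^ 4) / 12)"
  unfolding ch_Wbar_def
  by (rule form_jet_cong [OF form_jet_add [OF
        form_jet_diff [OF form_jet_diff [OF form_jet_ch_xiR_pow form_jet_const]
                          form_jet_diff [OF form_jet_ch_xiR_pow form_jet_const]]
        form_jet_mult [OF form_jet_const form_jet_diff [OF form_jet_ch_etaC form_jet_const]]]])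
     simp_all

lemma form_jet_P':
  "form_jet (P' a b) x c cb 0 (p1_TM x c cb - of_int (a\<^sup>2 + 2 * b\<^sup>2) * c\<^sup>2) 0"
proof (rule form_jetI [OF _ even_jet_fps_const_X_power2])
  have scaled: "(\<lambda>t. P' a b (\<lambda>j. t * x j) (t * c) (t * cb))
          = (\<lambda>t. (p1_TM x c cb - of_int (a\<^sup>2 + 2 * b\<^sup>2) * c\<^sup>2) * t ^ 2)"
    by (simp add: P'_def p1_TM_def p1_xiR_def algebra_simps flip: sum_distrib_left)
  show "(\<lambda>t. P' a b (\<lambda>j. t * x j) (t * c) (t * cb)) has_fps_expansion
          fps_const (p1_TM x c cb - of_int (a\<^sup>2 + 2 * b\<^sup>2) * c\<^sup>2) * fps_X ^ 2"
    unfolding scaled by (intro has_fps_expansion_cmult_left has_fps_expansion_fps_X_power)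
qed

theorem corollary4p3:
  fixes a b :: int and x :: "nat \<Rightarrow> real" and c cb :: real
  shows
  "deg_comp 8 (Abar_a a) x c cb - deg_comp 8 (Abar_b b) x c cb
     - 1/16 * deg_comp 8 (\<lambda>x c cb. Abar_b b x c cb * ch_Wbar a b x c cb) x c cb
   = - 1/24 * deg_comp 8 (\<lambda>x c cb. P' a b x c cb * Abar_a a x c cb) x c cb
     + 1/24 * deg_comp 8 (\<lambda>x c cb. P' a b x c cb * Abar_b b x c cb) x c cb
     + 1/384 * deg_comp 8 (\<lambda>x c cb. P' a b x c cb * Abar_b b x c cb * ch_Wbar a b x c cb) x c cb
     + 1/18432 * deg_comp 8 (\<lambda>x c cb. (P' a b x c cb)\<^sup>2 * 2 * ch_Wbar a b x c cb) x c cb"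
proof -
  note A = form_jet_Abar_a [of a x c cb] and B = form_jet_Abar_b [of b x c cb]
    and W = form_jet_ch_Wbar [of a b x c cb] and P = form_jet_P' [of a b x c cb]
  show ?thesis
    unfolding deg_comp_8_eq [OF A] deg_comp_8_eq [OF B] deg_comp_8_eq [OF form_jet_mult [OF B W]]
      deg_comp_8_eq [OF form_jet_mult [OF P A]] deg_comp_8_eq [OF form_jet_mult [OF P B]]
      deg_comp_8_eq [OF form_jet_mult [OF form_jet_mult [OF P B] W]]
      deg_comp_8_eq [OF form_jet_mult [OF form_jet_mult [OF form_jet_power2 [OF P] form_jet_const [of 2]] W]]
    by (simp add: field_simps)
qed

end
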